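(* There is an absolute constant $c>0$ such that the following holds. For any positive integers $n,d$ with $1\le d<n/8$, there exists a family of $d$-regular bipartite graphs with $n$ vertices on each side such that any deterministic algorithm for finding a perfect matching in the graphs of this family (given in adjacency array representation) requires at least $c\,nd$ time in the worst case over the graphs of the family and over the orderings of their adjacency arrays.
   Context: A bipartite graph $G=(P,Q,E)$ has vertex set $P\cup Q$ and edge set $E\subseteq P\times Q$; it is $d$-regular if every vertex has degree $d$, in which case $|P|=|Q|=n$ and $G$ has $nd$ edges. Adjacency array representation: for each vertex, its $d$ neighbors are stored in an array, and the algorithm accesses the graph by probing locations of these arrays, each probe revealing one neighbor of the chosen vertex. The ordering of neighbors within each array is arbitrary and may be chosen by an adversary. Each probe costs at least one unit of time. *)

theory Defs
  imports Complex_Main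
begin

section \<open>Bipartite graphs\<close>

record ('p, 'q) bigraph =
  lverts :: "'p set"
  rverts :: "'q set"
  edges :: "('p \<times> 'q) set"

definition bipartite_graph :: "('p, 'q) bigraph \<Rightarrow> bool" where
  "bipartite_graph G \<longleftrightarrow>
     finite (lverts G) \<and> finite (rverts G) \<and> edges G \<subseteq> lverts G \<times> rverts G"

text \<open>The two sides are kept disjoint by tagging them with \<^const>\<open>Inl\<close> and \<^const>\<open>Inr\<close>.\<close>

definition verts :: "('p, 'q) bigraph \<Rightarrow> ('p + 'q) set" where
  "verts G = lverts G <+> rverts G"

fun neighbors :: "('p, 'q) bigraph \<Rightarrow> 'p + 'q \<Rightarrow> ('p + 'q) set" where
  "neighbors G (Inl p) = Inr ` {q. (p, q) \<in> edges G}"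
| "neighbors G (Inr q) = Inl ` {p. (p, q) \<in> edges G}"

definition regular :: "nat \<Rightarrow> ('p, 'q) bigraph \<Rightarrow> bool" where
  "regular d G \<longleftrightarrow> (\<forall>v \<in> verts G. card (neighbors G v) = d)"

definition perfect_matching :: "('p, 'q) bigraph \<Rightarrow> ('p \<times> 'q) set \<Rightarrow> bool" where
  "perfect_matching G M \<longleftrightarrow>
     M \<subseteq> edges G \<and>
     (\<forall>p \<in> lverts G. \<exists>!q. (p, q) \<in> M) \<and>
     (\<forall>q \<in> rverts G. \<exists>!p. (p, q) \<in> M)"

section \<open>Adjacency arrays\<close>

text \<open>
  Every vertex, on either side, has an array listing its neighbors without repetition, in an
  arbitrary order. For a bipartite graph this forces the empty array at every
  \<open>v\<close> that is not a vertex, so the values there carry no information.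
\<close>

definition adjacency_arrays ::
    "('p, 'q) bigraph \<Rightarrow> ('p + 'q \<Rightarrow> ('p + 'q) list) \<Rightarrow> bool" where
  "adjacency_arrays G A \<longleftrightarrow> (\<forall>v. distinct (A v) \<and> set (A v) = neighbors G v)"

text \<open>A probe outside the bounds of an array is answered by \<^const>\<open>None\<close>.\<close>

definition lookup :: "('p + 'q \<Rightarrow> ('p + 'q) list) \<Rightarrow> 'p + 'q \<Rightarrow> nat \<Rightarrow> ('p + 'q) option" where
  "lookup A v i = (if i < length (A v) then Some (A v ! i) else None)"

section \<open>Deterministic algorithms\<close>

text \<open>
  An algorithm is represented by the tree of its possible behaviors: it returns a set of edges,
  spends one unit of time on internal computation, or probes a location of an adjacency array
  and continues depending on the answer. As only the answers to the probes depend on the input,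
  every deterministic machine unfolds to such a tree. The type is coinductive, so an algorithm need
  not terminate. \<open>Work\<close> steps also account for probes that cost more than one unit.
\<close>

codatatype ('p, 'q) algorithm =
    Return "('p \<times> 'q) set"
  | Work "('p, 'q) algorithm"
  | Probe "'p + 'q" nat "('p + 'q) option \<Rightarrow> ('p, 'q) algorithm"

text \<open>
  \<open>run A alg t M\<close>: with access to the adjacency arrays \<open>A\<close>, the algorithm \<open>alg\<close> halts after
  exactly \<open>t\<close> units of time and returns \<open>M\<close>. For given \<open>A\<close> and \<open>alg\<close> there is at most one such
  pair of \<open>t\<close> and \<open>M\<close>.
\<close>

inductive run ::
    "('p + 'q \<Rightarrow> ('p + 'q) list) \<Rightarrow> ('p, 'q) algorithm \<Rightarrow> nat \<Rightarrow> ('p \<times> 'q) set \<Rightarrow> bool"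
  for A where
  run_Return: "run A (Return M) 0 M"
| run_Work: "run A alg t M \<Longrightarrow> run A (Work alg) (Suc t) M"
| run_Probe: "run A (k (lookup A v i)) t M \<Longrightarrow> run A (Probe v i k) (Suc t) M"

definition finds_perfect_matchings ::
    "('p, 'q) algorithm \<Rightarrow> ('p, 'q) bigraph set \<Rightarrow> bool" where
  "finds_perfect_matchings alg \<F> \<longleftrightarrow>
     (\<forall>G \<in> \<F>. \<forall>A. adjacency_arrays G A \<longrightarrow> (\<exists>t M. run A alg t M \<and> perfect_matching G M))"

lemma run_deterministic:
  "run A alg t M \<Longrightarrow> run A alg t' M' \<Longrightarrow> t' = t \<and> M' = M"
proof (induction arbitrary: t' M' rule: run.induct)
  case (run_Return M)
  then show ?case by (auto elim: run.cases)
next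
  case (run_Work alg t M)
  from run_Work.prems show ?case by cases (use run_Work.IH in auto)
next
  case (run_Probe k v i t M)
  from run_Probe.prems show ?case by cases (use run_Probe.IH in auto)
qed

end

theory Submission
  imports Defs
begin

text \<open>
  An adversary fixes one \<open>d\<close>-regular graph and only chooses the order of its arrays. The graph consists
  mostly of disjoint blocks with \<open>d + h\<close> vertices on each side, where \<open>h = d div 2\<close>: on each side
  there are \<open>d\<close> ordinary and \<open>h\<close> special vertices; special vertices are joined to all ordinary vertices
  opposite, and the ordinary vertices are joined to each other by \<open>d - h\<close> hidden edges each. As a vertex
  with a hidden edge has \<open>h\<close> others, the adversary can show only these in the first \<open>h\<close> probes there.
  A perfect matching uses at least \<open>d - h\<close> hidden edges per block, but few probes exhaust few
  vertices, so some two blocks contain hidden matching edges \<open>(p, q)\<close> and \<open>(p', q')\<close> that are still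
  unprobed. Replacing them by \<open>(p, q')\<close> and \<open>(p', q)\<close> makes the output wrong without changing any answer.
\<close>

section \<open>Probed locations\<close>

text \<open>The recursion is on a time bound \<open>T\<close> because an algorithm need not
  terminate. \<open>Work\<close> uses up time as well, so the set covers the first \<open>T\<close>
  units of time.\<close>

primrec probes ::
    "nat \<Rightarrow> ('p + 'q \<Rightarrow> ('p + 'q) list) \<Rightarrow> ('p, 'q) algorithm \<Rightarrow> (('p + 'q) \<times> nat) set" where
  "probes 0 A alg = {}"
| "probes (Suc T) A alg =
     (case alg of
        Return M \<Rightarrow> {}
      | Work alg' \<Rightarrow> probes T A alg'
      | Probe v i k \<Rightarrow> insert (v, i) (probes T A (k (lookup A v i))))"

text \<open>Being in bounds is compared as well as the entries, because a probe out of bounds also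
  gets an answer.\<close>

definition agree_on ::
    "('v \<times> nat) set \<Rightarrow> ('v \<Rightarrow> 'v list) \<Rightarrow> ('v \<Rightarrow> 'v list) \<Rightarrow> bool" where
  "agree_on S A A' \<longleftrightarrow> (\<forall>(v, i) \<in> S. i < length (A v) \<longleftrightarrow> i < length (A' v)) \<and>
     (\<forall>(v, i) \<in> S. i < length (A v) \<longrightarrow> A v ! i = A' v ! i)"

lemma agree_on_lookup: "agree_on S A A' \<Longrightarrow> (v, i) \<in> S \<Longrightarrow> lookup A' v i = lookup A v i"
  by (fastforce simp: agree_on_def lookup_def)

lemma finite_probes: "finite (probes T A alg)"
  by (induction T arbitrary: alg) (auto split: algorithm.split)

lemma card_probes: "card (probes T A alg) \<le> T"
proof (induction T arbitrary: alg)
  case (Suc T)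
  show ?case
  proof (cases alg)
    case (Work alg')
    then show ?thesis using Suc[of alg'] by simp
  next
    case (Probe v i k)
    then show ?thesis
      using Suc[of "k (lookup A v i)"] by (simp add: finite_probes card_insert_if)
  qed simp
qed simp

text \<open>Since \<open>t\<close> is at most \<open>T\<close>, every probe of the run lies in the
  recorded set. It gets the same answer from \<open>A'\<close>, so the same branch is followed
  throughout.\<close>

lemma run_agree_on:
  assumes "run A alg t M" "t \<le> T" "agree_on (probes T A alg) A A'"
  shows "run A' alg t M"
  using assms
proof (induction arbitrary: T rule: run.induct)
  case (run_Return M)
  show ?case by (rule run.run_Return)
next
  case (run_Work alg t M)
  obtain T' where "T = Suc T'" using run_Work.prems(1) by (cases T) auto
  then show ?case using run_Work by (auto intro: run.run_Work)
next
  case (run_Probe k v i t M)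
  obtain T' where T: "T = Suc T'" using run_Probe.prems(1) by (cases T) auto
  have "lookup A' v i = lookup A v i"
    using run_Probe.prems(2) by (rule agree_on_lookup) (simp add: T)
  moreover have "run A' (k (lookup A v i)) t M"
    using run_Probe.prems T by (intro run_Probe.IH[of T']) (auto simp: agree_on_def)
  ultimately show ?case by (intro run.run_Probe) simp
qed

section \<open>The adversary\<close>

text \<open>\<open>H v\<close> consists of the neighbors to be kept secret at \<open>v\<close>, and
  \<open>h\<close> is the budget of probes per vertex. Once more than \<open>h\<close> locations of
  \<open>v\<close> are probed, \<open>v\<close> is exhausted and may reveal everything.\<close>

definition concealed ::
    "nat \<Rightarrow> ('v \<Rightarrow> 'v set) \<Rightarrow> ('v \<Rightarrow> 'v list) \<Rightarrow> ('v \<times> nat) set \<Rightarrow> bool" where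
  "concealed h H A S \<longleftrightarrow>
     (\<forall>v. card {i. (v, i) \<in> S} \<le> h \<longrightarrow> (\<forall>i. (v, i) \<in> S \<longrightarrow> i < length (A v) \<longrightarrow> A v ! i \<notin> H v))"

text \<open>If the new probe would reveal a secret neighbor too early, the entry there is swapped
  with a harmless one from an unprobed location. One exists because \<open>v\<close> has at least
  \<open>h\<close> harmless neighbors and fewer than \<open>h\<close> locations probed
  before.\<close>

lemma concealed_insert:
  assumes A: "adjacency_arrays G A" and S: "finite S" and conc: "concealed h H A S"
    and many: "\<And>v. H v \<inter> neighbors G v \<noteq> {} \<Longrightarrow> h \<le> card (neighbors G v - H v)"
  shows "\<exists>A'. adjacency_arrays G A' \<and> agree_on S A A' \<and> concealed h H A' (insert (v, i) S)"
proof -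
  let ?I = "{i. (v, i) \<in> S}"
  have fin_I: "finite ?I"
    using finite_vimageI[OF S, of "Pair v"] by (simp add: vimage_def inj_on_def)
  have insert_I: "{j. (u, j) \<in> insert (v, i) S} = (if u = v then insert i ?I else {i. (u, i) \<in> S})" for u
    by auto
  show ?thesis
  \<comment> \<open>This is the only situation in which the arrays must be changed.\<close>
  proof (cases "(v, i) \<notin> S \<and> card (insert i ?I) \<le> h \<and> i < length (A v) \<and> A v ! i \<in> H v")
    case False
    have "concealed h H A (insert (v, i) S)"
      unfolding concealed_def
    proof (intro allI impI)
      fix u j
      assume le: "card {j. (u, j) \<in> insert (v, i) S} \<le> h" and mem: "(u, j) \<in> insert (v, i) S"
        and j: "j < length (A u)"
      have "card {i. (u, i) \<in> S} \<le> card {j. (u, j) \<in> insert (v, i) S}"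
        unfolding insert_I using fin_I by (auto intro: card_mono)
      with le conc j have "(u, j) \<in> S \<Longrightarrow> A u ! j \<notin> H u"
        by (auto simp: concealed_def)
      moreover have "A u ! j \<notin> H u" if "(u, j) = (v, i)" "(v, i) \<notin> S"
        using False le j that unfolding insert_I by auto
      ultimately show "A u ! j \<notin> H u" using mem by auto
    qed
    then show ?thesis using A by (auto simp: agree_on_def)
  next
    case True
    let ?J = "{j. j < length (A v) \<and> A v ! j \<notin> H v}"
    have dist: "distinct (A v)" and set: "set (A v) = neighbors G v"
      using A by (auto simp: adjacency_arrays_def)
    have "A v ! i \<in> H v \<inter> neighbors G v" using True set by (metis IntI nth_mem)
    then have "h \<le> card (neighbors G v - H v)" using many by blast
    also have "neighbors G v - H v = (!) (A v) ` ?J"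
      unfolding set[symmetric] by (auto simp: set_conv_nth)
    also have "card \<dots> = card ?J"
      by (rule card_image) (use dist in \<open>auto simp: inj_on_def nth_eq_iff_index_eq\<close>)
    finally have J: "h \<le> card ?J" .
    \<comment> \<open>Location \<open>i\<close> is new and the count including it is at most
      \<open>h\<close>, so \<open>?I\<close> has fewer than \<open>h\<close> elements while
      \<open>?J\<close> has at least \<open>h\<close>.\<close>
    have "\<not> ?J \<subseteq> ?I"
    proof
      assume "?J \<subseteq> ?I"
      then have "card ?J \<le> card ?I" using fin_I by (rule card_mono[rotated])
      moreover have "card (insert i ?I) = Suc (card ?I)" using True fin_I by simp
      ultimately show False using J True by simp
    qed
    then obtain j where j: "j < length (A v)" "A v ! j \<notin> H v" "(v, j) \<notin> S" by auto
    define A' where "A' = A(v := (A v)[i := A v ! j, j := A v ! i])"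
    have "adjacency_arrays G A'"
      using A True j by (auto simp: adjacency_arrays_def A'_def)
    moreover have len: "length (A' u) = length (A u)" for u
      by (simp add: A'_def)
    moreover have old: "A' u ! l = A u ! l" if "(u, l) \<in> S" for u l
    proof -
      have "(u, l) \<noteq> (v, i)" "(u, l) \<noteq> (v, j)" using that True j by metis+
      then show ?thesis by (cases "u = v") (simp_all add: A'_def)
    qed
    ultimately have "adjacency_arrays G A'" "agree_on S A A'"
      by (auto simp: agree_on_def)
    moreover have "concealed h H A' (insert (v, i) S)"
      unfolding concealed_def
    proof (intro allI impI)
      fix u l
      assume le: "card {j. (u, j) \<in> insert (v, i) S} \<le> h" and mem: "(u, l) \<in> insert (v, i) S"
        and l: "l < length (A' u)"
      have "card {i. (u, i) \<in> S} \<le> card {j. (u, j) \<in> insert (v, i) S}"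
        unfolding insert_I using fin_I by (auto intro: card_mono)
      with le conc l len old have "(u, l) \<in> S \<Longrightarrow> A' u ! l \<notin> H u"
        by (simp add: concealed_def)
      moreover have "A' v ! i \<notin> H v"
        using True j by (cases "i = j") (simp_all add: A'_def)
      ultimately show "A' u ! l \<notin> H u" using mem by auto
    qed
    ultimately show ?thesis by blast
  qed
qed

text \<open>The arrays are rearranged probe by probe along the algorithm. Generalizing over the set
  \<open>S\<close> of locations already answered ensures that later swaps leave earlier answers
  intact.\<close>

lemma concealed_probes:
  assumes "adjacency_arrays G A" "finite S" "concealed h H A S"
    and many: "\<And>v. H v \<inter> neighbors G v \<noteq> {} \<Longrightarrow> h \<le> card (neighbors G v - H v)"
  shows "\<exists>A'. adjacency_arrays G A' \<and> agree_on S A A' \<and> concealed h H A' (S \<union> probes T A' alg)"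
  using assms(1-3)
proof (induction T arbitrary: A S alg)
  case 0
  then show ?case by (auto simp: agree_on_def)
next
  case (Suc T)
  show ?case
  proof (cases alg)
    case (Return M)
    then show ?thesis using Suc.prems by (auto simp: agree_on_def)
  next
    case (Work alg')
    then show ?thesis using Suc.IH[OF Suc.prems, of alg'] by simp
  next
    case (Probe v i k)
    obtain A1 where A1: "adjacency_arrays G A1" "agree_on S A A1"
        "concealed h H A1 (insert (v, i) S)"
      using concealed_insert[OF Suc.prems many] by metis
    obtain A2 where A2: "adjacency_arrays G A2" "agree_on (insert (v, i) S) A1 A2"
        "concealed h H A2 (insert (v, i) S \<union> probes T A2 (k (lookup A1 v i)))"
      using Suc.IH[OF A1(1) _ A1(3)] Suc.prems(2) by (metis finite_insert)
    \<comment> \<open>The final arrays still give the answer that selected the continuation, so the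
      probes made on \<open>A2\<close> are those that the induction hypothesis covers.\<close>
    have "lookup A2 v i = lookup A1 v i" using A2(2) by (rule agree_on_lookup) simp
    then have "concealed h H A2 (S \<union> probes (Suc T) A2 alg)"
      using A2(3) by (simp add: Probe)
    moreover have "agree_on S A A2"
      using A1(2) A2(2) by (fastforce simp: agree_on_def)
    ultimately show ?thesis using A2(1) by blast
  qed
qed

text \<open>Double counting: each exhausted vertex accounts for at least \<open>Suc h\<close> probed
  locations.\<close>

lemma card_exhausted:
  assumes "finite S"
  shows "finite {v. h < card {i. (v, i) \<in> S}}"
    and "card {v. h < card {i. (v, i) \<in> S}} * Suc h \<le> card S"
proof -
  let ?B = "{v. h < card {i. (v, i) \<in> S}}" and ?I = "\<lambda>v. {i. (v, i) \<in> S}"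
  have "?B \<subseteq> fst ` S"
  proof
    fix v assume "v \<in> ?B"
    then have "?I v \<noteq> {}" by (metis card.empty mem_Collect_eq not_less_zero)
    then show "v \<in> fst ` S" by force
  qed
  then show fin: "finite ?B" using assms by (meson finite_imageI finite_subset)
  have fin_I: "finite (?I v)" for v
    using finite_vimageI[OF assms, of "Pair v"] by (simp add: vimage_def inj_on_def)
  have "card ?B * Suc h = (\<Sum>v\<in>?B. Suc h)" by simp
  also have "\<dots> \<le> (\<Sum>v\<in>?B. card (?I v))" by (rule sum_mono) auto
  also have "\<dots> = card (Sigma ?B ?I)" using fin fin_I by (simp add: card_SigmaI)
  also have "\<dots> \<le> card S" using assms by (intro card_mono) auto
  finally show "card ?B * Suc h \<le> card S" .
qed

section \<open>Switching two edges\<close>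

definition switch ::
    "'p \<Rightarrow> 'q \<Rightarrow> 'p \<Rightarrow> 'q \<Rightarrow> ('p, 'q) bigraph \<Rightarrow> ('p, 'q) bigraph" where
  "switch p q p' q' G = G\<lparr>edges := edges G - {(p, q), (p', q')} \<union> {(p, q'), (p', q)}\<rparr>"

text \<open>Applied to the entries of the array at \<open>v\<close>, this realizes the switch
  without moving any position: it affects only the four endpoints, and there only the entry that
  names the removed edge.\<close>

fun switch_map :: "'p \<Rightarrow> 'q \<Rightarrow> 'p \<Rightarrow> 'q \<Rightarrow> 'p + 'q \<Rightarrow> 'p + 'q \<Rightarrow> 'p + 'q" where
  "switch_map p q p' q' (Inl x) =
     (if x = p then id(Inr q := Inr q') else if x = p' then id(Inr q' := Inr q) else id)"
| "switch_map p q p' q' (Inr y) =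
     (if y = q then id(Inl p := Inl p') else if y = q' then id(Inl p' := Inl p) else id)"

lemma inj_on_id_upd: "y \<notin> X \<Longrightarrow> inj_on (id(x := y)) X"
  by (auto simp: inj_on_def)

text \<open>The new neighbor of each endpoint was not adjacent to it before, so the renaming is
  injective on the old neighborhood and creates no repetition.\<close>

lemma adjacency_arrays_switch:
  assumes A: "adjacency_arrays G A"
    and e: "(p, q) \<in> edges G" "(p', q') \<in> edges G" "(p, q') \<notin> edges G" "(p', q) \<notin> edges G"
  shows "adjacency_arrays (switch p q p' q' G) (\<lambda>v. map (switch_map p q p' q' v) (A v))"
proof -
  have ne: "p \<noteq> p'" "q \<noteq> q'" using e by auto
  let ?G' = "switch p q p' q' G"
  have "inj_on (switch_map p q p' q' v) (neighbors G v) \<and>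
      switch_map p q p' q' v ` neighbors G v = neighbors ?G' v" for v
  proof (cases v)
    case (Inl x)
    consider "x = p" | "x = p'" "x \<noteq> p" | "x \<noteq> p" "x \<noteq> p'" by blast
    then show ?thesis
    proof cases
      case 1
      have "neighbors ?G' v = insert (Inr q') (neighbors G v - {Inr q})"
        using e ne by (auto simp: Inl 1 switch_def)
      then show ?thesis using e ne by (auto simp: Inl 1 fun_upd_image intro!: inj_on_id_upd)
    next
      case 2
      have "neighbors ?G' v = insert (Inr q) (neighbors G v - {Inr q'})"
        using e ne 2 by (auto simp: Inl switch_def)
      then show ?thesis using e ne 2 by (auto simp: Inl fun_upd_image intro!: inj_on_id_upd)
    qed (auto simp: Inl switch_def)
  next
    case (Inr y)
    consider "y = q" | "y = q'" "y \<noteq> q" | "y \<noteq> q" "y \<noteq> q'" by blast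
    then show ?thesis
    proof cases
      case 1
      have "neighbors ?G' v = insert (Inl p') (neighbors G v - {Inl p})"
        using e ne by (auto simp: Inr 1 switch_def)
      then show ?thesis using e ne by (auto simp: Inr 1 fun_upd_image intro!: inj_on_id_upd)
    next
      case 2
      have "neighbors ?G' v = insert (Inl p) (neighbors G v - {Inl p'})"
        using e ne 2 by (auto simp: Inr switch_def)
      then show ?thesis using e ne 2 by (auto simp: Inr fun_upd_image intro!: inj_on_id_upd)
    qed (auto simp: Inr switch_def)
  qed
  then show ?thesis
    using A by (auto simp: adjacency_arrays_def distinct_map)
qed

text \<open>Degrees are array lengths, and renaming entries preserves these.\<close>

lemma card_neighbors_switch:
  assumes "adjacency_arrays G A"
    and "(p, q) \<in> edges G" "(p', q') \<in> edges G" "(p, q') \<notin> edges G" "(p', q) \<notin> edges G"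
  shows "card (neighbors (switch p q p' q' G) v) = card (neighbors G v)"
proof -
  have "card (neighbors H v) = length (A v)" if "adjacency_arrays H A" for H A
    using that distinct_card[of "A v"] by (simp add: adjacency_arrays_def)
  from this[OF assms(1)] this[OF adjacency_arrays_switch[OF assms]] show ?thesis by simp
qed

text \<open>The family of the theorem. Taking all \<open>d\<close>-regular graphs on the two sides
  ensures that a switched graph belongs to it again.\<close>

definition regular_graphs :: "'p set \<Rightarrow> 'q set \<Rightarrow> nat \<Rightarrow> ('p, 'q) bigraph set" where
  "regular_graphs P Q d = {G. bipartite_graph G \<and> lverts G = P \<and> rverts G = Q \<and> regular d G}"

lemma switch_regular_graphs:
  assumes G: "G \<in> regular_graphs P Q d" and A: "adjacency_arrays G A"
    and e: "(p, q) \<in> edges G" "(p', q') \<in> edges G" "(p, q') \<notin> edges G" "(p', q) \<notin> edges G"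
  shows "switch p q p' q' G \<in> regular_graphs P Q d"
proof -
  have "bipartite_graph (switch p q p' q' G)"
    using G e by (auto simp: regular_graphs_def bipartite_graph_def switch_def)
  moreover have "regular d (switch p q p' q' G)"
    using G card_neighbors_switch[OF A e]
    by (auto simp: regular_graphs_def regular_def verts_def switch_def)
  ultimately show ?thesis
    using G by (simp add: regular_graphs_def) (simp add: switch_def)
qed

lemma ex_adjacency_arrays:
  assumes "bipartite_graph G"
  shows "\<exists>A. adjacency_arrays G A"
proof -
  have "finite (edges G)"
    using assms finite_subset unfolding bipartite_graph_def by blast
  have "finite {q. (p, q) \<in> edges G}" "finite {p. (p, q) \<in> edges G}" for p q
    using finite_vimageI[OF \<open>finite (edges G)\<close>, of "Pair p"]
      finite_vimageI[OF \<open>finite (edges G)\<close>, of "\<lambda>p. (p, q)"]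
    by (simp_all add: vimage_def inj_on_def)
  then have "finite (neighbors G v)" for v by (cases v) auto
  then have "\<forall>v. \<exists>xs. distinct xs \<and> set xs = neighbors G v"
    by (metis finite_distinct_list)
  then show ?thesis unfolding adjacency_arrays_def by (rule choice)
qed

section \<open>Time lower bound from concealable and switchable edges\<close>

text \<open>\<open>C\<close> is the set of hidden edges: \<open>many\<close> lets the adversary
  conceal them, and in \<open>robust\<close> the set \<open>B\<close> stands for the exhausted
  vertices. If every run on \<open>G\<close> halted within time \<open>T\<close>, switching two
  hidden edges with no exhausted endpoint would leave the run unchanged, although its output uses a
  removed edge.\<close>

lemma slow_run:
  assumes G: "G \<in> regular_graphs P Q d"
    and alg: "finds_perfect_matchings alg (regular_graphs P Q d)"
    and C: "C \<subseteq> edges G"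
    and many: "\<And>v. neighbors (G\<lparr>edges := C\<rparr>) v \<noteq> {} \<Longrightarrow>
      h \<le> card (neighbors G v - neighbors (G\<lparr>edges := C\<rparr>) v)"
    and robust: "\<And>M B. perfect_matching G M \<Longrightarrow> finite B \<Longrightarrow> card B * Suc h \<le> T \<Longrightarrow>
      \<exists>p q p' q'. (p, q) \<in> M \<inter> C \<and> (p', q') \<in> C \<and> (p, q') \<notin> edges G \<and> (p', q) \<notin> edges G \<and>
        {Inl p, Inl p', Inr q, Inr q'} \<inter> B = {}"
  shows "\<exists>A t M. adjacency_arrays G A \<and> run A alg t M \<and> T < t"
proof (rule ccontr)
  assume fast: "\<not> ?thesis"
  let ?H = "neighbors (G\<lparr>edges := C\<rparr>)"
  have "bipartite_graph G" using G by (simp add: regular_graphs_def)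
  then obtain A0 where A0: "adjacency_arrays G A0" using ex_adjacency_arrays by blast
  have "concealed h ?H A0 {}" by (simp add: concealed_def)
  then have "\<exists>A. adjacency_arrays G A \<and> agree_on {} A0 A \<and> concealed h ?H A ({} \<union> probes T A alg)"
    by (intro concealed_probes[OF A0] many) auto
  then obtain A where A: "adjacency_arrays G A" and conc: "concealed h ?H A (probes T A alg)"
    by auto
  let ?S = "probes T A alg"
  define B where "B = {v. h < card {i. (v, i) \<in> ?S}}"
  have B: "finite B" "card B * Suc h \<le> T"
    using card_exhausted[OF finite_probes, of h T A alg] card_probes[of T A alg]
    by (auto simp: B_def)
  from alg G A obtain t M where run: "run A alg t M" and M: "perfect_matching G M"
    unfolding finds_perfect_matchings_def by blast
  have t: "t \<le> T" using fast run A by (metis not_le_imp_less)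
  from robust[OF M B] obtain p q p' q'
    where pq: "(p, q) \<in> M" "(p, q) \<in> C" "(p', q') \<in> C" "(p, q') \<notin> edges G" "(p', q) \<notin> edges G"
      and free: "Inl p \<notin> B" "Inl p' \<notin> B" "Inr q \<notin> B" "Inr q' \<notin> B" by auto
  have e: "(p, q) \<in> edges G" "(p', q') \<in> edges G" using pq C by auto
  let ?A' = "\<lambda>v. map (switch_map p q p' q' v) (A v)"
  have A': "adjacency_arrays (switch p q p' q' G) ?A'"
    using A e pq by (intro adjacency_arrays_switch)
  \<comment> \<open>An exhausted vertex is none of the four endpoints, so the map is the identity
    there. At any other vertex the probed entries name no hidden edge, and only hidden edges are
    renamed.\<close>
  have fixed: "switch_map p q p' q' v (A v ! i) = A v ! i"
    if "(v, i) \<in> ?S" "i < length (A v)" for v i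
  proof (cases "v \<in> B")
    case True
    then show ?thesis using free by (cases v) auto
  next
    case False
    then have "A v ! i \<notin> ?H v" using conc that by (auto simp: concealed_def B_def)
    then show ?thesis using pq by (cases v) auto
  qed
  then have "agree_on ?S A ?A'" by (auto simp: agree_on_def)
  with run t have run': "run ?A' alg t M" by (rule run_agree_on)
  have "switch p q p' q' G \<in> regular_graphs P Q d"
    using G A e pq by (intro switch_regular_graphs)
  with alg A' obtain t' M' where "run ?A' alg t' M'" "perfect_matching (switch p q p' q' G) M'"
    unfolding finds_perfect_matchings_def by blast
  \<comment> \<open>By determinism the correct output on the switched graph is again
    \<open>M\<close>, which contains the removed edge \<open>(p, q)\<close>.\<close>
  with run' have "perfect_matching (switch p q p' q' G) M"
    using run_deterministic by metis
  then show False using pq e by (auto simp: perfect_matching_def switch_def)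
qed

section \<open>The hard graph\<close>

text \<open>A circulant bipartite graph. Using the sum of the indices instead of the difference
  makes it symmetric, so that counting degrees on one side suffices.\<close>

definition circ :: "nat \<Rightarrow> nat \<Rightarrow> nat \<Rightarrow> nat \<Rightarrow> bool" where
  "circ m e i j \<longleftrightarrow> i < m \<and> j < m \<and> (i + j) mod m < e"

lemma circ_sym: "circ m e i j \<longleftrightarrow> circ m e j i"
  by (auto simp: circ_def add.commute)

text \<open>Adding \<open>i\<close> modulo \<open>m\<close> permutes \<open>{..<m}\<close>, so
  exactly \<open>e\<close> indices land below \<open>e\<close>.\<close>

lemma card_circ:
  assumes "e \<le> m" "i < m"
  shows "card {j. circ m e i j} = e"
proof -
  let ?f = "\<lambda>j. (i + j) mod m"
  have inj: "inj_on ?f {..<m}"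
  proof (rule inj_onI)
    fix x y assume xy: "x \<in> {..<m}" "y \<in> {..<m}" "?f x = ?f y"
    have *: "?f z = (if i + z < m then i + z else i + z - m)" if "z < m" for z
      using assms that by (simp add: le_mod_geq)
    show "x = y" using xy *[of x] *[of y] by (auto split: if_splits)
  qed
  have surj: "?f ` {..<m} = {..<m}"
    by (rule endo_inj_surj) (use inj assms in auto)
  have "{j. circ m e i j} = {j \<in> {..<m}. ?f j \<in> {..<e}}"
    using assms by (auto simp: circ_def)
  also have "?f ` \<dots> = ?f ` {..<m} \<inter> {..<e}" by blast
  finally have "?f ` {j. circ m e i j} = {..<e}"
    using assms unfolding surj by auto
  then have "card (?f ` {j. circ m e i j}) = e" by simp
  moreover have "inj_on ?f {j. circ m e i j}"
    by (rule inj_on_subset[OF inj]) (auto simp: circ_def)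
  ultimately show ?thesis by (simp add: card_image)
qed

text \<open>Indices below \<open>d\<close> are ordinary, the following \<open>h\<close> special. An
  ordinary vertex has \<open>h\<close> special neighbors and \<open>d - h\<close> circulant ones, a
  special vertex all \<open>d\<close> ordinary ones.\<close>

definition block :: "nat \<Rightarrow> nat \<Rightarrow> nat \<Rightarrow> nat \<Rightarrow> bool" where
  "block d h i j \<longleftrightarrow> i < d \<and> d \<le> j \<and> j < d + h \<or> d \<le> i \<and> i < d + h \<and> j < d \<or> circ d (d - h) i j"

lemma block_sym: "block d h i j \<longleftrightarrow> block d h j i"
  using circ_sym by (auto simp: block_def)

lemma block_less: "block d h i j \<Longrightarrow> j < d + h"
  by (auto simp: block_def circ_def)

lemma card_block:
  assumes "h \<le> d" "i < d + h"
  shows "card {j. block d h i j} = d"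
proof (cases "i < d")
  case True
  then have "{j. block d h i j} = {d..<d + h} \<union> {j. circ d (d - h) i j}"
    by (auto simp: block_def)
  also have "card \<dots> = card {d..<d + h} + card {j. circ d (d - h) i j}"
    by (rule card_Un_disjoint) (auto simp: circ_def)
  finally show ?thesis using True assms by (simp add: card_circ)
next
  case False
  then have "{j. block d h i j} = {..<d}" using assms by (auto simp: block_def circ_def)
  then show ?thesis by simp
qed

text \<open>A vertex \<open>x\<close> is at position \<open>x mod (d + h)\<close> of block
  \<open>x div (d + h)\<close>; only the first \<open>k\<close> blocks contain hidden edges.\<close>

definition hidden :: "nat \<Rightarrow> nat \<Rightarrow> nat \<Rightarrow> (nat \<times> nat) set" where
  "hidden k d h = {(x, y). x div (d + h) = y div (d + h) \<and> x div (d + h) < k \<and>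
     circ d (d - h) (x mod (d + h)) (y mod (d + h))}"

text \<open>There are \<open>k\<close> consecutive blocks; the remaining vertices carry a circulant graph.\<close>

definition hard_edges :: "nat \<Rightarrow> nat \<Rightarrow> nat \<Rightarrow> nat \<Rightarrow> (nat \<times> nat) set" where
  "hard_edges n k d h =
     {(x, y). x div (d + h) = y div (d + h) \<and> x div (d + h) < k \<and>
        block d h (x mod (d + h)) (y mod (d + h))} \<union>
     {(x, y). k * (d + h) \<le> x \<and> k * (d + h) \<le> y \<and>
        circ (n - k * (d + h)) d (x - k * (d + h)) (y - k * (d + h))}"

definition hard_graph :: "nat \<Rightarrow> nat \<Rightarrow> nat \<Rightarrow> nat \<Rightarrow> (nat, nat) bigraph" where
  "hard_graph n k d h = \<lparr>lverts = {..<n}, rverts = {..<n}, edges = hard_edges n k d h\<rparr>"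

lemma hidden_sym: "(x, y) \<in> hidden k d h \<longleftrightarrow> (y, x) \<in> hidden k d h"
  using circ_sym by (auto simp: hidden_def)

lemma hard_edges_sym: "(x, y) \<in> hard_edges n k d h \<longleftrightarrow> (y, x) \<in> hard_edges n k d h"
  using circ_sym block_sym by (auto simp: hard_edges_def)

lemma hidden_subset: "hidden k d h \<subseteq> hard_edges n k d h"
  by (auto simp: hidden_def hard_edges_def block_def)

lemma hard_edges_less:
  assumes "(x, y) \<in> hard_edges n k d h" "0 < d" "k * (d + h) \<le> n"
  shows "x < n"
proof -
  have "x < n" if "x div (d + h) < k"
    using that assms by (meson add_pos_nonneg div_less_iff_less_mult less_le_trans zero_le)
  then show ?thesis using assms(1) by (auto simp: hard_edges_def circ_def)
qed

text \<open>A vertex of the first \<open>k\<close> blocks lies below \<open>k * (d + h)\<close>,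
  which excludes the edges of the remainder. Hence pairs across blocks are non-edges, as switching
  requires.\<close>

lemma hard_edges_same_block:
  assumes "(x, y) \<in> hard_edges n k d h" "x div (d + h) < k" "0 < d"
  shows "y div (d + h) = x div (d + h)" "block d h (x mod (d + h)) (y mod (d + h))"
proof -
  have "x < k * (d + h)" using assms(2,3) by (simp add: div_less_iff_less_mult)
  then show "y div (d + h) = x div (d + h)" "block d h (x mod (d + h)) (y mod (d + h))"
    using assms(1) by (auto simp: hard_edges_def)
qed

lemma mult_add_div_mod:
  fixes b s j :: nat
  assumes "j < s"
  shows "(b * s + j) div s = b" "(b * s + j) mod s = j"
  using assms by auto

text \<open>Neighborhoods are translates of those in \<open>block\<close> or in the circulant
  remainder. The latter has at least \<open>d\<close> vertices per side by the assumption on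
  \<open>n\<close>, enough for degree \<open>d\<close>.\<close>

lemma card_hard_edges:
  assumes "h \<le> d" "0 < d" "k * (d + h) + d \<le> n" "x < n"
  shows "card {y. (x, y) \<in> hard_edges n k d h} = d"
proof (cases "x div (d + h) < k")
  case True
  have lt: "x < k * (d + h)" using True assms(2) by (simp add: div_less_iff_less_mult)
  let ?g = "\<lambda>j. x div (d + h) * (d + h) + j"
  have "{y. (x, y) \<in> hard_edges n k d h} = ?g ` {j. block d h (x mod (d + h)) j}"
  proof (intro equalityI subsetI)
    fix y assume "y \<in> {y. (x, y) \<in> hard_edges n k d h}"
    then have "y div (d + h) = x div (d + h)" "block d h (x mod (d + h)) (y mod (d + h))"
      using hard_edges_same_block[OF _ True assms(2)] by auto
    moreover have "y = y div (d + h) * (d + h) + y mod (d + h)"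
      by (rule div_mult_mod_eq[symmetric])
    ultimately show "y \<in> ?g ` {j. block d h (x mod (d + h)) j}"
      by (metis image_eqI mem_Collect_eq)
  next
    fix y assume "y \<in> ?g ` {j. block d h (x mod (d + h)) j}"
    then obtain j where j: "block d h (x mod (d + h)) j" "y = ?g j" by auto
    then have "y div (d + h) = x div (d + h)" "y mod (d + h) = j"
      using mult_add_div_mod[OF block_less[OF j(1)]] by (simp_all only: j(2))
    then show "y \<in> {y. (x, y) \<in> hard_edges n k d h}"
      using j True by (auto simp: hard_edges_def)
  qed
  moreover have "card (?g ` {j. block d h (x mod (d + h)) j}) = d"
    using assms by (simp add: card_image card_block)
  ultimately show ?thesis by simp
next
  case False
  let ?a = "k * (d + h)"
  have ge: "?a \<le> x" using False assms(2) by (simp add: div_less_iff_less_mult)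
  have "{y. (x, y) \<in> hard_edges n k d h} = (+) ?a ` {j. circ (n - ?a) d (x - ?a) j}"
  proof (intro equalityI subsetI)
    fix y assume "y \<in> {y. (x, y) \<in> hard_edges n k d h}"
    then have "?a \<le> y" "circ (n - ?a) d (x - ?a) (y - ?a)"
      using False by (auto simp: hard_edges_def)
    then show "y \<in> (+) ?a ` {j. circ (n - ?a) d (x - ?a) j}"
      by (metis image_eqI le_add_diff_inverse mem_Collect_eq)
  qed (use ge in \<open>auto simp: hard_edges_def\<close>)
  moreover have "card ((+) ?a ` {j. circ (n - ?a) d (x - ?a) j}) = d"
    using assms ge by (simp add: card_image card_circ)
  ultimately show ?thesis by simp
qed

lemma hard_graph_regular:
  assumes "h \<le> d" "0 < d" "k * (d + h) + d \<le> n"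
  shows "hard_graph n k d h \<in> regular_graphs {..<n} {..<n} d"
proof -
  have "card {y. (x, y) \<in> hard_edges n k d h} = d" "card {y. (y, x) \<in> hard_edges n k d h} = d"
    if "x < n" for x
    using card_hard_edges[OF assms that] hard_edges_sym by auto
  then have "regular d (hard_graph n k d h)"
    by (auto simp: regular_def verts_def hard_graph_def card_image)
  moreover have "hard_edges n k d h \<subseteq> {..<n} \<times> {..<n}"
    using hard_edges_less assms hard_edges_sym by fastforce
  ultimately show ?thesis by (simp add: regular_graphs_def bipartite_graph_def hard_graph_def)
qed

section \<open>Hidden edges at a vertex and in a perfect matching\<close>

text \<open>An endpoint of a hidden edge is ordinary, and its edges to the \<open>h\<close> special
  vertices of its block are not hidden.\<close>

lemma card_not_hidden:
  assumes "(x, y) \<in> hidden k d h" "h \<le> d" "0 < d" "k * (d + h) + d \<le> n"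
  shows "h \<le> card {z. (x, z) \<in> hard_edges n k d h - hidden k d h}"
proof -
  have x: "x div (d + h) < k" "x mod (d + h) < d" "x < n"
    using assms hidden_subset[of k d h n] hard_edges_less[of x y n k d h]
    by (auto simp: hidden_def circ_def)
  let ?g = "\<lambda>j. x div (d + h) * (d + h) + j"
  have "?g ` {d..<d + h} \<subseteq> {z. (x, z) \<in> hard_edges n k d h - hidden k d h}"
  proof
    fix y assume "y \<in> ?g ` {d..<d + h}"
    then obtain j where j: "y = ?g j" "d \<le> j" "j < d + h"
      by (elim imageE) (simp only: atLeastLessThan_iff)
    then have "y div (d + h) = x div (d + h)" "y mod (d + h) = j"
      using mult_add_div_mod[of j "d + h"] by (simp_all only:)
    then show "y \<in> {z. (x, z) \<in> hard_edges n k d h - hidden k d h}"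
      using x j(2,3) by (simp add: hard_edges_def hidden_def block_def circ_def)
  qed
  \<comment> \<open>Finiteness follows from the cardinality being \<open>d\<close>, which is
    positive.\<close>
  moreover have "finite {z. (x, z) \<in> hard_edges n k d h}"
    using card_hard_edges[OF assms(2-4) x(3)] assms(3) by (intro card_ge_0_finite) simp
  then have "finite {z. (x, z) \<in> hard_edges n k d h - hidden k d h}"
    by (rule rev_finite_subset) auto
  ultimately have "card (?g ` {d..<d + h}) \<le> card {z. (x, z) \<in> hard_edges n k d h - hidden k d h}"
    by (rule card_mono[rotated])
  then show ?thesis by (simp add: card_image)
qed

lemma card_neighbors_not_hidden:
  assumes "neighbors (hard_graph n k d h\<lparr>edges := hidden k d h\<rparr>) v \<noteq> {}"
    and "h \<le> d" "0 < d" "k * (d + h) + d \<le> n"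
  shows "h \<le> card (neighbors (hard_graph n k d h) v -
    neighbors (hard_graph n k d h\<lparr>edges := hidden k d h\<rparr>) v)"
proof (cases v)
  case (Inl x)
  have "neighbors (hard_graph n k d h) v - neighbors (hard_graph n k d h\<lparr>edges := hidden k d h\<rparr>) v
      = Inr ` {z. (x, z) \<in> hard_edges n k d h - hidden k d h}"
    by (auto simp: Inl hard_graph_def)
  moreover obtain y where "(x, y) \<in> hidden k d h" using assms(1) by (auto simp: Inl)
  ultimately show ?thesis using card_not_hidden[OF _ assms(2-4)] by (simp add: card_image)
next
  case (Inr x)
  have "neighbors (hard_graph n k d h) v - neighbors (hard_graph n k d h\<lparr>edges := hidden k d h\<rparr>) v
      = Inl ` {z. (x, z) \<in> hard_edges n k d h - hidden k d h}"
    using hidden_sym hard_edges_sym by (auto simp: Inr hard_graph_def)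
  moreover obtain y where "(x, y) \<in> hidden k d h"
    using assms(1) hidden_sym by (auto simp: Inr)
  ultimately show ?thesis using card_not_hidden[OF _ assms(2-4)] by (simp add: card_image)
qed

text \<open>In each block, the first \<open>d\<close> left vertices reach only \<open>h\<close> right vertices by edges that are
  not hidden.\<close>

lemma matching_hidden_block:
  assumes f: "\<And>x. x < n \<Longrightarrow> (x, f x) \<in> hard_edges n k d h" "inj_on f {..<n}"
    and b: "b < k" "0 < d" "k * (d + h) \<le> n"
  shows "d - h \<le> card {x. x < n \<and> x div (d + h) = b \<and> (x, f x) \<in> hidden k d h}"
    (is "_ \<le> card ?Z")
proof -
  define a where "a = b * (d + h)"
  \<comment> \<open>\<open>?X\<close> holds the ordinary left vertices of block \<open>b\<close>,
    \<open>?Y\<close> its special right vertices.\<close>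
  let ?X = "{a..<a + d}" and ?Y = "{a + d..<a + d + h}"
  have "a + (d + h) \<le> k * (d + h)"
    using mult_le_mono1[of "Suc b" k "d + h"] b(1) by (simp add: a_def)
  then have X_n: "?X \<subseteq> {..<n}" using b(3) by auto
  have X_div: "x div (d + h) = b" "x mod (d + h) < d" if "x \<in> ?X" for x
  proof -
    have i: "x - a < d" "a + (x - a) = x" using that by auto
    then have "x - a < d + h" by simp
    from mult_add_div_mod[OF this, of b, folded a_def]
    show "x div (d + h) = b" "x mod (d + h) < d" unfolding i(2) using i(1) by simp_all
  qed
  have sub: "?X \<subseteq> {x \<in> ?X. f x \<in> ?Y} \<union> ?Z"
  proof
    fix x assume x: "x \<in> ?X"
    then have n: "x < n" using X_n by auto
    have y: "f x div (d + h) = b" "block d h (x mod (d + h)) (f x mod (d + h))"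
      using hard_edges_same_block[OF f(1)[OF n]] X_div[OF x] b by auto
    show "x \<in> {x \<in> ?X. f x \<in> ?Y} \<union> ?Z"
    proof (cases "circ d (d - h) (x mod (d + h)) (f x mod (d + h))")
      case True
      then show ?thesis using n y X_div[OF x] b by (auto simp: hidden_def)
    next
      case False
      then have "d \<le> f x mod (d + h)" "f x mod (d + h) < d + h"
        using y X_div[OF x] by (auto simp: block_def)
      moreover have "f x = a + f x mod (d + h)"
        unfolding a_def using div_mult_mod_eq[of "f x" "d + h"] y(1) by simp
      ultimately have "f x \<in> ?Y" unfolding atLeastLessThan_iff by linarith
      then show ?thesis using x by auto
    qed
  qed
  \<comment> \<open>By injectivity, at most \<open>h\<close> ordinary vertices are matched to
    special ones; all others use hidden edges.\<close>
  have "card {x \<in> ?X. f x \<in> ?Y} = card (f ` {x \<in> ?X. f x \<in> ?Y})"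
    by (rule card_image[symmetric], rule inj_on_subset[OF f(2)]) (use X_n in auto)
  also have "\<dots> \<le> card ?Y" by (rule card_mono) auto
  finally have Y: "card {x \<in> ?X. f x \<in> ?Y} \<le> h" by simp
  have "d = card ?X" by simp
  also have "\<dots> \<le> card ({x \<in> ?X. f x \<in> ?Y} \<union> ?Z)" by (rule card_mono[OF _ sub]) simp
  also have "\<dots> \<le> card {x \<in> ?X. f x \<in> ?Y} + card ?Z" by (rule card_Un_le)
  finally show ?thesis using Y by simp
qed

text \<open>Otherwise all hidden matching edges avoiding \<open>B\<close> lie in a single block. The
  other blocks, at least \<open>k - 1\<close> many, have at least \<open>d - h\<close> hidden
  matching edges each. All of these meet \<open>B\<close>, and since they are disjoint they need
  distinct elements of \<open>B\<close>.\<close>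

lemma two_free_hidden_edges:
  assumes f: "\<And>x. x < n \<Longrightarrow> (x, f x) \<in> hard_edges n k d h" "inj_on f {..<n}"
    and d: "0 < d" "k * (d + h) \<le> n"
    and B: "finite B" "card B < (k - 1) * (d - h)"
  shows "\<exists>x x'. x < n \<and> x' < n \<and> x div (d + h) \<noteq> x' div (d + h) \<and>
    (x, f x) \<in> hidden k d h \<and> (x', f x') \<in> hidden k d h \<and>
    {Inl x, Inl x', Inr (f x), Inr (f x')} \<inter> B = {}"
proof (rule ccontr)
  assume none: "\<not> ?thesis"
  let ?free = "\<lambda>x. x < n \<and> (x, f x) \<in> hidden k d h \<and> Inl x \<notin> B \<and> Inr (f x) \<notin> B"
  let ?Z = "\<lambda>b. {x. x < n \<and> x div (d + h) = b \<and> (x, f x) \<in> hidden k d h}"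
  \<comment> \<open>If no vertex is free, any \<open>b0\<close> will do; it may even lie outside the
    \<open>k\<close> blocks.\<close>
  obtain b0 where b0: "\<And>x. ?free x \<Longrightarrow> x div (d + h) = b0"
    using none by (cases "\<exists>x. ?free x") (fastforce, blast)
  let ?W = "\<Union>b\<in>{..<k} - {b0}. ?Z b"
  \<comment> \<open>Each matching edge counted in \<open>?W\<close> is charged to an endpoint in
    \<open>B\<close>, the left one if possible.\<close>
  let ?g = "\<lambda>x. if Inl x \<in> B then Inl x else Inr (f x)"
  have "(k - 1) * (d - h) \<le> card ({..<k} - {b0}) * (d - h)"
    by (intro mult_le_mono1) (simp add: card_Diff_singleton_if)
  also have "\<dots> = (\<Sum>b\<in>{..<k} - {b0}. d - h)" by simp
  also have "\<dots> \<le> (\<Sum>b\<in>{..<k} - {b0}. card (?Z b))"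
    by (intro sum_mono matching_hidden_block) (use f d in auto)
  also have "\<dots> = card ?W" by (rule card_UN_disjoint[symmetric]) auto
  also have "\<dots> = card (?g ` ?W)"
    by (rule card_image[symmetric]) (use f(2) in \<open>auto simp: inj_on_def split: if_splits\<close>)
  also have "\<dots> \<le> card B"
    by (rule card_mono[OF B(1)]) (use b0 in auto)
  finally show False using B(2) by simp
qed

text \<open>Viewed as an injective function, the matching has two free hidden edges in different
  blocks; no edge joins different blocks, so the crossing pairs are non-edges.\<close>

lemma hard_graph_robust:
  assumes M: "perfect_matching (hard_graph n k d h) M"
    and d: "0 < d" "k * (d + h) \<le> n"
    and B: "finite B" "card B < (k - 1) * (d - h)"
  shows "\<exists>p q p' q'. (p, q) \<in> M \<inter> hidden k d h \<and> (p', q') \<in> hidden k d h \<and>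
    (p, q') \<notin> edges (hard_graph n k d h) \<and> (p', q) \<notin> edges (hard_graph n k d h) \<and>
    {Inl p, Inl p', Inr q, Inr q'} \<inter> B = {}"
proof -
  have sub: "M \<subseteq> hard_edges n k d h"
    and left: "\<And>x. x < n \<Longrightarrow> \<exists>y. (x, y) \<in> M"
    and right: "\<And>y. y < n \<Longrightarrow> \<exists>!x. (x, y) \<in> M"
    using M by (auto simp: perfect_matching_def hard_graph_def)
  define f where "f x = (SOME y. (x, y) \<in> M)" for x
  have f: "(x, f x) \<in> M" if "x < n" for x
    unfolding f_def using left[OF that] by (rule someI_ex)
  have "f x < n" if "x < n" for x
    using f[OF that] sub hard_edges_sym hard_edges_less d by blast
  then have "inj_on f {..<n}"
    using right f unfolding inj_on_def by (metis lessThan_iff)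
  then obtain x x' where x: "x < n" "x' < n" "x div (d + h) \<noteq> x' div (d + h)"
      "(x, f x) \<in> hidden k d h" "(x', f x') \<in> hidden k d h"
      "{Inl x, Inl x', Inr (f x), Inr (f x')} \<inter> B = {}"
    using two_free_hidden_edges[of n f k d h B] f sub d B by blast
  have "(x, f x') \<notin> hard_edges n k d h" "(x', f x) \<notin> hard_edges n k d h"
    using hard_edges_same_block(1)[of x "f x'" n k d h] hard_edges_same_block(1)[of x' "f x" n k d h]
      x d by (auto simp: hidden_def)
  then show ?thesis
    using x f by (intro exI[of _ x] exI[of _ "f x"] exI[of _ x'] exI[of _ "f x'"])
      (simp add: hard_graph_def)
qed

section \<open>Choice of parameters and conclusion\<close>

text \<open>With \<open>h\<close> about \<open>d / 2\<close>, both \<open>d - h\<close> and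
  \<open>Suc h\<close> are at least \<open>d / 2\<close> and a block has at most
  \<open>3 * d / 2\<close> vertices per side. The remaining \<open>d\<close> vertices are reserved
  for the circulant part.\<close>

lemma many_blocks:
  fixes n d :: nat
  assumes "0 < d" "8 * d < n"
  defines "h \<equiv> d div 2"
  defines "k \<equiv> (n - d) div (d + h)"
  shows "k * (d + h) + d \<le> n" "n * d div 16 < (k - 1) * (d - h) * Suc h"
proof -
  have "k * (d + h) \<le> n - d" by (simp add: k_def)
  then show "k * (d + h) + d \<le> n" using assms(2) by linarith
  define s where "s = d + h"
  define e where "e = d - h"
  have s: "2 * s \<le> 3 * d" "0 < s" and e: "d \<le> 2 * e" "d \<le> 2 * Suc h"
    using assms(1) by (simp_all add: s_def e_def h_def)
  have k: "k = (n - d) div s" by (simp add: k_def s_def)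
  have "k \<noteq> 0" using s assms(2) by (auto simp: k div_eq_0_iff)
  then obtain l where l: "k = Suc l" by (cases k) auto
  have "n - d < s + k * s" unfolding k using s(2) by (rule dividend_less_div_times)
  then have "n - d < 2 * s + l * s" by (simp add: l)
  \<comment> \<open>Here \<open>2 * s\<close> is at most \<open>3 * d\<close>, so
    \<open>n < 4 * d + l * s\<close>, and \<open>4 * d\<close> is less than half of
    \<open>n\<close>.\<close>
  then have "n < 2 * (l * s)" using s(1) assms(2) by linarith
  also have "\<dots> = l * (2 * s)" by simp
  also have "\<dots> \<le> l * (3 * d)" using s(1) by (rule mult_le_mono2)
  finally have "n * d < l * (3 * d) * d" using assms(1) by simp
  also have "\<dots> = 3 * l * (d * d)" by simp
  also have "\<dots> \<le> 3 * l * ((2 * e) * (2 * Suc h))"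
    by (intro mult_le_mono2 mult_le_mono e)
  also have "\<dots> = 12 * (l * e * Suc h)" by (simp add: algebra_simps)
  \<comment> \<open>The estimate gives the factor 12, so the constant 16 leaves some slack.\<close>
  finally have "n * d div 16 < l * e * Suc h" by linarith
  then show "n * d div 16 < (k - 1) * (d - h) * Suc h" by (simp add: l e_def)
qed

theorem theorem2:
  "\<exists>c::real. c > 0 \<and>
     (\<forall>n d :: nat. 1 \<le> d \<and> real d < real n / 8 \<longrightarrow>
       (\<exists>\<F> :: (nat, nat) bigraph set.
          (\<forall>G \<in> \<F>. bipartite_graph G \<and> lverts G = {..<n} \<and> rverts G = {..<n} \<and> regular d G) \<and>
          (\<forall>alg. finds_perfect_matchings alg \<F> \<longrightarrow>
             (\<exists>G \<in> \<F>. \<exists>A t M.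
                adjacency_arrays G A \<and> run A alg t M \<and> real t \<ge> c * real n * real d))))"
proof (rule exI[of _ "1 / 16"], intro conjI allI impI)
  fix n d :: nat
  assume "1 \<le> d \<and> real d < real n / 8"
  then have d: "0 < d" "8 * d < n" by auto
  define h where "h = d div 2"
  define k where "k = (n - d) div (d + h)"
  \<comment> \<open>Rounding down costs nothing: a running time strictly above \<open>T\<close>
    exceeds \<open>n * d / 16\<close>.\<close>
  define T where "T = n * d div 16"
  have k: "k * (d + h) + d \<le> n" "T < (k - 1) * (d - h) * Suc h"
    using many_blocks[OF d] by (auto simp: h_def k_def T_def)
  have h: "h \<le> d" by (simp add: h_def)
  let ?G = "hard_graph n k d h" and ?F = "regular_graphs {..<n} {..<n} d :: (nat, nat) bigraph set"
  have G: "?G \<in> ?F" using hard_graph_regular[OF h d(1) k(1)] .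
  have "\<exists>G \<in> ?F. \<exists>A t M. adjacency_arrays G A \<and> run A alg t M \<and> real t \<ge> 1 / 16 * real n * real d"
    if alg: "finds_perfect_matchings alg ?F" for alg
  proof -
    have "\<exists>A t M. adjacency_arrays ?G A \<and> run A alg t M \<and> T < t"
    proof (rule slow_run[OF G alg])
      show "hidden k d h \<subseteq> edges ?G" using hidden_subset by (simp add: hard_graph_def)
    next
      fix M and B :: "(nat + nat) set"
      assume M: "perfect_matching ?G M" and B: "finite B" "card B * Suc h \<le> T"
      have "card B * Suc h < (k - 1) * (d - h) * Suc h" using B(2) k(2) by simp
      then have "card B < (k - 1) * (d - h)" using mult_less_cancel2 by blast
      then show "\<exists>p q p' q'. (p, q) \<in> M \<inter> hidden k d h \<and> (p', q') \<in> hidden k d h \<and>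
          (p, q') \<notin> edges ?G \<and> (p', q) \<notin> edges ?G \<and> {Inl p, Inl p', Inr q, Inr q'} \<inter> B = {}"
        using hard_graph_robust[OF M d(1) _ B(1)] k(1) by simp
    qed (use card_neighbors_not_hidden h d(1) k(1) in blast)
    then obtain A t M where run: "adjacency_arrays ?G A" "run A alg t M" and "T < t" by blast
    then have "n * d < 16 * t" by (simp add: T_def)
    then have "real (n * d) < real (16 * t)" by (simp only: of_nat_less_iff)
    then have "real t \<ge> 1 / 16 * real n * real d" by simp
    then show ?thesis using G run by blast
  qed
  moreover have "\<forall>G \<in> ?F. bipartite_graph G \<and> lverts G = {..<n} \<and> rverts G = {..<n} \<and> regular d G"
    by (simp add: regular_graphs_def)
  ultimately show "\<exists>\<F> :: (nat, nat) bigraph set.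
      (\<forall>G \<in> \<F>. bipartite_graph G \<and> lverts G = {..<n} \<and> rverts G = {..<n} \<and> regular d G) \<and>
      (\<forall>alg. finds_perfect_matchings alg \<F> \<longrightarrow>
         (\<exists>G \<in> \<F>. \<exists>A t M.
            adjacency_arrays G A \<and> run A alg t M \<and> real t \<ge> 1 / 16 * real n * real d))"
    by blast
qed simp

end
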